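(* Let $p$ be an odd prime and let $q\in\mathbb{C}_p$ with $|1-q|_p<1$. For $m,n,k\in\mathbb{Z}_+$ with $m+n>2k$, $$\int_{\mathbb{Z}_p}B_{k,n}(x)B_{k,m}(x)\,q^{1-x}\,d\mu_{-1}(x)=\begin{cases}2q+E_{n+m,q}, & k=0,\\[1mm] \binom{n}{k}\binom{m}{k}\displaystyle\sum_{j=0}^{2k}\binom{2k}{j}(-1)^{j+2k}E_{n+m-j,q}, & k>0.\end{cases}$$
   Context: $\mathbb{C}_p$ denotes the completion of an algebraic closure of $\mathbb{Q}_p$; $\mathbb{Z}_+=\{0,1,2,\dots\}$. For $q\in\mathbb{C}_p$ with $|1-q|_p<1$, the $q$-Euler numbers $E_{n,q}$ are defined by $\frac{2}{qe^t+1}=\sum_{n\ge0}E_{n,q}\frac{t^n}{n!}$ (formal power series in $t$). For $x\in\mathbb{Z}_p$, $q^x=\sum_{r\ge0}\binom{x}{r}(q-1)^r$ and $q^{1-x}=q\cdot(q^{-1})^x$. Binomial coefficients are $\binom{n}{k}=\frac{n(n-1)\cdots(n-k+1)}{k!}$ (zero when $k>n$), and the Bernstein polynomial is $B_{k,n}(x)=\binom{n}{k}x^k(1-x)^{n-k}$, regarded as a polynomial function on $\mathbb{Z}_p$ (the zero polynomial when $k>n$). For a uniformly differentiable $f:\mathbb{Z}_p\to\mathbb{C}_p$, the fermionic $p$-adic integral is $\int_{\mathbb{Z}_p}f(x)\,d\mu_{-1}(x)=\lim_{N\to\infty}\sum_{x=0}^{p^N-1}f(x)(-1)^x$. *)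

theory Defs
  imports "HOL-Analysis.Analysis" "HOL-Computational_Algebra.Computational_Algebra"
begin

definition padic_abs_rat :: "nat \<Rightarrow> rat \<Rightarrow> real" where
  "padic_abs_rat p r =
     (if r = 0 then 0
      else case quotient_of r of (a, b) \<Rightarrow>
        real p powi (int (multiplicity (int p) b) - int (multiplicity (int p) a)))"

definition is_algebraic_closure_of :: "'a::field set \<Rightarrow> 'a set \<Rightarrow> bool" where
  "is_algebraic_closure_of L K \<longleftrightarrow>
     K \<subseteq> L \<and>
     (\<forall>x\<in>L. \<forall>y\<in>L. x - y \<in> L \<and> x * y \<in> L \<and> inverse x \<in> L) \<and>
     (\<forall>x\<in>L. \<exists>f. f \<noteq> 0 \<and> (\<forall>i. coeff f i \<in> K) \<and> poly f x = 0) \<and>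
     (\<forall>f. degree f > 0 \<and> (\<forall>i. coeff f i \<in> L) \<longrightarrow> (\<exists>x\<in>L. poly f x = 0))"

text \<open>
  In a complete valued field whose absolute value restricts to the \<open>p\<close>-adic one on the
  rationals, the closure of the rationals is their completion, i.e. the field of
  \<open>p\<close>-adic numbers.
\<close>

definition padic_numbers :: "'a::{field_char_0, topological_space} set" where
  "padic_numbers = closure (range of_rat)"

definition padic_integers :: "('a::{field_char_0, topological_space} \<Rightarrow> real) \<Rightarrow> 'a set" where
  "padic_integers absv = {x \<in> padic_numbers. absv x \<le> 1}"

text \<open>
  The type \<open>'a\<close> with absolute value \<open>absv\<close> is a completion of an algebraic
  closure \<open>L\<close> of the \<open>p\<close>-adic numbers: it is complete (by its type class) and
  \<open>L\<close> is dense in it. This describes the field of \<open>p\<close>-adic complex numbers up to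
  isometric isomorphism.
\<close>

locale padic_complex_field =
  fixes p :: nat
    and absv :: "'a::{field_char_0, complete_space} \<Rightarrow> real"
  assumes prime_p: "prime p"
    and dist_absv: "dist x y = absv (x - y)"
    and absv_mult: "absv (x * y) = absv x * absv y"
    and absv_ultrametric: "absv (x + y) \<le> max (absv x) (absv y)"
    and absv_of_rat: "absv (of_rat r) = padic_abs_rat p r"
    and dense_algebraic_closure:
      "\<exists>L. is_algebraic_closure_of L (padic_numbers :: 'a set) \<and> closure L = UNIV"

definition q_euler :: "'a::field_char_0 \<Rightarrow> nat \<Rightarrow> 'a" where
  "q_euler q n = fact n * fps_nth (fps_const 2 / (fps_const q * fps_exp 1 + 1)) n"

definition padic_power :: "'a::{field_char_0, topological_space} \<Rightarrow> 'a \<Rightarrow> 'a" where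
  "padic_power q x = (\<Sum>r. (x gchoose r) * (q - 1) ^ r)"

definition padic_power_one_minus :: "'a::{field_char_0, topological_space} \<Rightarrow> 'a \<Rightarrow> 'a" where
  "padic_power_one_minus q x = q * padic_power (inverse q) x"

definition bernstein_poly :: "nat \<Rightarrow> nat \<Rightarrow> 'a::comm_ring_1 \<Rightarrow> 'a" where
  "bernstein_poly k n x = of_nat (n choose k) * x ^ k * (1 - x) ^ (n - k)"

text \<open>
  Uniform differentiability in the \<open>p\<close>-adic sense: at every point \<open>a\<close> the difference
  quotient in both variables has a limit as they tend jointly to \<open>a\<close>.
\<close>

definition uniformly_differentiable_on ::
    "('a::{field, metric_space} \<Rightarrow> 'a) \<Rightarrow> 'a set \<Rightarrow> bool" where
  "uniformly_differentiable_on f S \<longleftrightarrow>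
     (\<forall>a\<in>S. \<exists>l. ((\<lambda>(x, y). (f x - f y) / (x - y)) \<longlongrightarrow> l)
        (at (a, a) within {(x, y). x \<in> S \<and> y \<in> S \<and> x \<noteq> y}))"

definition has_fermionic_integral ::
    "nat \<Rightarrow> ('a::{field_char_0, metric_space} \<Rightarrow> real) \<Rightarrow> ('a \<Rightarrow> 'a) \<Rightarrow> 'a \<Rightarrow> bool" where
  "has_fermionic_integral p absv f I \<longleftrightarrow>
     uniformly_differentiable_on f (padic_integers absv) \<and>
     (\<lambda>N. \<Sum>x<p ^ N. f (of_nat x) * (-1) ^ x) \<longlonglongrightarrow> I"

end

theory Submission
  imports Defs "HOL-Number_Theory.Cong"
begin

text \<open>
  Expanding \<open>x ^ (2 * k) = (1 - (1 - x)) ^ (2 * k)\<close> reduces the integral to those of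
  \<open>(1 - x) ^ i * q ^ (1 - x)\<close>. Since \<open>p\<close> is odd, the alternating sum of \<open>G (x + 1) + G x\<close> over
  \<open>x < p ^ N\<close> telescopes to \<open>G 0 + G (p ^ N)\<close>, which tends to \<open>2 * G 0\<close> for continuous \<open>G\<close>; this
  yields a recurrence identifying these integrals as \<open>2 * q + E i\<close> for \<open>i > 0\<close>. For \<open>k > 0\<close> the
  contributions \<open>2 * q\<close> cancel because the alternating sum of binomial coefficients vanishes.

  Uniform differentiability of \<open>q ^ x\<close> follows from Vandermonde's identity, which gives
  \<open>absv ((x gchoose r) - (y gchoose r)) \<le> r * absv (x - y)\<close> on the \<open>p\<close>-adic integers, so that the
  difference quotients of the binomial series converge uniformly.
\<close>

context padic_complex_field
begin

section \<open>The absolute value\<close>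

lemma absv_0 [simp]: "absv 0 = 0"
  using dist_absv[of 0 0] by simp

lemma absv_nonneg [simp]: "absv x \<ge> 0"
  using dist_absv[of x 0] by (metis diff_zero zero_le_dist)

lemma absv_eq_0_iff [simp]: "absv x = 0 \<longleftrightarrow> x = 0"
  using dist_absv[of x 0] by (metis diff_zero dist_eq_0_iff)

lemma absv_1 [simp]: "absv 1 = 1"
  using absv_mult[of 1 1] by simp

lemma absv_minus_commute: "absv (x - y) = absv (y - x)"
  by (metis dist_absv dist_commute)

lemma absv_minus [simp]: "absv (- x) = absv x"
  using absv_minus_commute[of 0 x] by simp

lemma absv_diff_le: "absv (x - y) \<le> max (absv x) (absv y)"
  using absv_ultrametric[of x "- y"] by simp

lemma absv_triangle: "absv (x + y) \<le> absv x + absv y"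
  using absv_ultrametric[of x y] absv_nonneg[of x] absv_nonneg[of y] by linarith

lemma absv_power [simp]: "absv (x ^ n) = absv x ^ n"
  by (induction n) (simp_all add: absv_mult)

lemma absv_inverse [simp]: "absv (inverse x) = inverse (absv x)"
proof (cases "x = 0")
  case False
  then have "absv x * absv (inverse x) = 1"
    by (simp flip: absv_mult)
  then show ?thesis
    by (simp add: inverse_unique)
qed simp

lemma absv_divide: "absv (x / y) = absv x / absv y"
  by (simp add: field_class.field_divide_inverse absv_mult divide_real_def)

text \<open>The largest summand bounds an ultrametric sum, with no factor for the number of terms.
  The condition \<open>B \<ge> 0\<close> covers empty and infinite index sets, where the sum is
  0.\<close>

lemma absv_sum_le:
  assumes "\<And>i. i \<in> A \<Longrightarrow> absv (f i) \<le> B" and "B \<ge> 0"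
  shows "absv (sum f A) \<le> B"
  using assms
proof (induction A rule: infinite_finite_induct)
  case (insert a A)
  then have "absv (f a) \<le> B" "absv (sum f A) \<le> B"
    by auto
  then have "absv (f a + sum f A) \<le> B"
    using absv_ultrametric[of "f a" "sum f A"] by linarith
  with insert show ?case
    by simp
qed auto

lemma absv_of_int:
  assumes "i \<noteq> 0"
  shows "absv (of_int i) = 1 / real p ^ multiplicity (int p) i"
proof -
  have "absv (of_int i) = padic_abs_rat p (of_int i)"
    using absv_of_rat[of "of_int i"] by simp
  also have "\<dots> = 1 / real p ^ multiplicity (int p) i"
    using assms by (simp add: padic_abs_rat_def power_int_minus divide_simps)
  finally show ?thesis .
qed

lemma p_gt_1: "p > 1"
  using prime_p prime_gt_1_nat by blast

lemma absv_of_int_le_1: "absv (of_int i) \<le> 1"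
proof (cases "i = 0")
  case False
  have "real p ^ multiplicity (int p) i \<ge> 1"
    using p_gt_1 by (intro one_le_power) auto
  then show ?thesis
    using False p_gt_1 by (simp add: absv_of_int divide_le_eq_1)
qed simp

lemma absv_of_nat_le_1: "absv (of_nat n) \<le> 1"
  using absv_of_int_le_1[of "int n"] by simp

text \<open>The power of \<open>p\<close> dividing \<open>n\<close> is at most \<open>n\<close>.
  This bounds the denominators of binomial coefficients polynomially, which a geometric factor can
  absorb.\<close>

lemma absv_of_nat_ge:
  assumes "n > 0"
  shows "absv (of_nat n) \<ge> 1 / real n"
proof -
  have "int p ^ multiplicity (int p) (int n) dvd int n"
    by (rule multiplicity_dvd)
  then have "int p ^ multiplicity (int p) (int n) \<le> int n"
    using assms by (intro zdvd_imp_le) auto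
  then have "real p ^ multiplicity (int p) (int n) \<le> real n"
    by (metis of_int_le_iff of_int_of_nat_eq of_int_power)
  moreover have "real p ^ multiplicity (int p) (int n) > 0"
    using p_gt_1 by simp
  ultimately show ?thesis
    using absv_of_int[of "int n"] assms by (simp add: frac_le)
qed

lemma absv_of_int_eq_1:
  assumes "\<not> int p dvd i"
  shows "absv (of_int i) = 1"
  using assms absv_of_int[of i] by (cases "i = 0") (simp_all add: not_dvd_imp_multiplicity_0)

lemma absv_p: "absv (of_nat p) = 1 / real p"
proof -
  have "multiplicity (int p) (int p) = 1"
    using prime_p p_gt_1 by (intro multiplicity_self) auto
  then show ?thesis
    using absv_of_int[of "int p"] p_gt_1 by simp
qed

lemma absv_of_int_dvd_le:
  assumes "int p ^ N dvd i"
  shows "absv (of_int i) \<le> 1 / real p ^ N"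
proof -
  obtain j where j: "i = int p ^ N * j"
    using assms by blast
  have "absv (of_int i) = (1 / real p) ^ N * absv (of_int j)"
    by (simp add: j absv_mult absv_p)
  also have "\<dots> \<le> (1 / real p) ^ N * 1"
    by (intro mult_left_mono absv_of_int_le_1) auto
  finally show ?thesis
    by (simp add: power_divide)
qed

lemma p_power_inverse_less:
  assumes "e > 0"
  obtains N where "1 / real p ^ N < e"
proof -
  have "1 / real p < 1"
    using p_gt_1 by simp
  then obtain N where "(1 / real p) ^ N < e"
    using real_arch_pow_inv[OF assms] by blast
  with that show ?thesis
    by (simp add: power_divide)
qed

section \<open>Limits\<close>

text \<open>The topology of the type is only known to come from the metric, so the continuity of
  the field operations has to be derived from the absolute value.\<close>

lemma tendsto_absv_iff: "(f \<longlongrightarrow> l) F \<longleftrightarrow> ((\<lambda>x. absv (f x - l)) \<longlongrightarrow> 0) F"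
  by (subst tendsto_dist_iff) (simp add: dist_absv)

lemma tendsto_absv_bound:
  assumes "(g \<longlongrightarrow> 0) F" and "eventually (\<lambda>x. absv (f x - l) \<le> g x) F"
  shows "(f \<longlongrightarrow> l) F"
  unfolding tendsto_absv_iff
  by (rule tendsto_sandwich[OF _ assms(2) tendsto_const assms(1)]) simp

lemma tendsto_add_absv:
  fixes f g :: "'b \<Rightarrow> 'a"
  assumes "(f \<longlongrightarrow> l) F" and "(g \<longlongrightarrow> m) F"
  shows "((\<lambda>x. f x + g x) \<longlongrightarrow> l + m) F"
proof (rule tendsto_absv_bound)
  show "((\<lambda>x. absv (f x - l) + absv (g x - m)) \<longlongrightarrow> 0) F"
    using assms unfolding tendsto_absv_iff by (rule tendsto_add_zero)
  have "absv (f x + g x - (l + m)) \<le> absv (f x - l) + absv (g x - m)" for x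
    using absv_triangle[of "f x - l" "g x - m"] by (simp add: algebra_simps)
  then show "eventually (\<lambda>x. absv (f x + g x - (l + m)) \<le> absv (f x - l) + absv (g x - m)) F"
    by simp
qed

lemma tendsto_mult_absv:
  fixes f g :: "'b \<Rightarrow> 'a"
  assumes "(f \<longlongrightarrow> l) F" and "(g \<longlongrightarrow> m) F"
  shows "((\<lambda>x. f x * g x) \<longlongrightarrow> l * m) F"
proof (rule tendsto_absv_bound)
  let ?f = "\<lambda>x. absv (f x - l)" and ?g = "\<lambda>x. absv (g x - m)"
  let ?h = "\<lambda>x. ?f x * ?g x + (?f x * absv m + absv l * ?g x)"
  show "(?h \<longlongrightarrow> 0) F"
    using assms unfolding tendsto_absv_iff by (auto intro!: tendsto_eq_intros)
  have "absv (f x * g x - l * m) \<le> ?h x" for x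
  proof -
    have "f x * g x - l * m = (f x - l) * (g x - m) + ((f x - l) * m + l * (g x - m))"
      by (simp add: algebra_simps)
    also have "absv \<dots> \<le> ?h x"
      by (intro order_trans[OF absv_triangle] add_mono order_trans[OF absv_triangle])
         (simp_all add: absv_mult)
    finally show ?thesis .
  qed
  then show "eventually (\<lambda>x. absv (f x * g x - l * m) \<le> ?h x) F"
    by simp
qed

lemma tendsto_cmult_absv:
  fixes f :: "'b \<Rightarrow> 'a"
  shows "(f \<longlongrightarrow> l) F \<Longrightarrow> ((\<lambda>x. c * f x) \<longlongrightarrow> c * l) F"
  by (rule tendsto_mult_absv[OF tendsto_const])

lemma tendsto_diff_absv:
  fixes f g :: "'b \<Rightarrow> 'a"
  assumes "(f \<longlongrightarrow> l) F" and "(g \<longlongrightarrow> m) F"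
  shows "((\<lambda>x. f x - g x) \<longlongrightarrow> l - m) F"
  using tendsto_add_absv[OF assms(1) tendsto_cmult_absv[OF assms(2), of "-1"]] by simp

lemma tendsto_power_absv:
  fixes f :: "'b \<Rightarrow> 'a"
  shows "(f \<longlongrightarrow> l) F \<Longrightarrow> ((\<lambda>x. f x ^ n) \<longlongrightarrow> l ^ n) F"
  by (induction n) (auto intro: tendsto_mult_absv)

lemma tendsto_sum_absv:
  fixes f :: "'c \<Rightarrow> 'b \<Rightarrow> 'a"
  assumes "\<And>i. i \<in> A \<Longrightarrow> (f i \<longlongrightarrow> l i) F"
  shows "((\<lambda>x. \<Sum>i\<in>A. f i x) \<longlongrightarrow> (\<Sum>i\<in>A. l i)) F"
  using assms by (induction A rule: infinite_finite_induct) (auto intro: tendsto_add_absv)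

text \<open>In a complete ultrametric field it suffices that the terms tend to 0: a block of the
  series is no larger than its largest term. Any two late partial sums are compared through the
  common one at \<open>R\<close>.\<close>

lemma summable_absv:
  assumes "(\<lambda>r. absv (f r)) \<longlonglongrightarrow> 0"
  shows "summable f"
proof -
  have "Cauchy (\<lambda>n. sum f {..<n})"
  proof (rule metric_CauchyI)
    fix e :: real
    assume "e > 0"
    then obtain R where R: "absv (f r) < e / 2" if "r \<ge> R" for r
      using order_tendstoD(2)[OF assms, of "e / 2"] by (auto simp: eventually_sequentially)
    have tail: "absv (sum f {..<n} - sum f {..<R}) \<le> e / 2" if "n \<ge> R" for n
    proof -
      have "sum f {..<n} - sum f {..<R} = sum f {R..<n}"
        using that by (simp add: lessThan_atLeast0 sum_diff_nat_ivl)
      also have "absv \<dots> \<le> e / 2"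
        using R \<open>e > 0\<close> by (intro absv_sum_le) (auto intro: less_imp_le)
      finally show ?thesis .
    qed
    have "dist (sum f {..<m}) (sum f {..<n}) < e" if "m \<ge> R" "n \<ge> R" for m n
      using absv_diff_le[of "sum f {..<m} - sum f {..<R}" "sum f {..<n} - sum f {..<R}"]
        tail[OF that(1)] tail[OF that(2)] \<open>e > 0\<close> by (simp add: dist_absv)
    then show "\<exists>M. \<forall>m\<ge>M. \<forall>n\<ge>M. dist (sum f {..<m}) (sum f {..<n}) < e"
      by blast
  qed
  then show ?thesis
    by (simp add: summable_iff_convergent Cauchy_convergent)
qed

text \<open>Closed balls are closed under limits. The centre \<open>c\<close> and the starting index
  \<open>N\<close> serve two uses: \<open>c = 0\<close> bounds a limit, and \<open>c\<close> a
  partial sum bounds the tail of a series.\<close>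

lemma absv_limit_le:
  assumes "X \<longlonglongrightarrow> l" and "\<And>n. n \<ge> N \<Longrightarrow> absv (X n - c) \<le> B"
  shows "absv (l - c) \<le> B"
proof (rule field_le_epsilon)
  fix e :: real
  assume "e > 0"
  with assms(1) have "\<forall>\<^sub>F n in sequentially. absv (X n - l) < e"
    by (auto simp: tendsto_iff dist_absv)
  then have "\<forall>\<^sub>F n in sequentially. absv (X n - l) < e \<and> n \<ge> N"
    using eventually_ge_at_top by (rule eventually_conj)
  then obtain n where n: "absv (X n - l) < e" "n \<ge> N"
    by (auto simp: eventually_sequentially)
  have "absv (l - c) \<le> absv (l - X n) + absv (X n - c)"
    using absv_triangle[of "l - X n" "X n - c"] by simp
  with n assms(2)[OF n(2)] show "absv (l - c) \<le> B + e"
    by (simp add: absv_minus_commute)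
qed

section \<open>The \<open>p\<close>-adic integers\<close>

text \<open>A rational in the unit ball has a denominator prime to \<open>p\<close>, which is
  invertible modulo every power of \<open>p\<close>.\<close>

lemma rat_approx_by_int:
  assumes "absv (of_rat r) \<le> 1" and "e > 0"
  obtains i where "absv (of_rat r - of_int i) < e"
proof -
  obtain a b where ab: "quotient_of r = (a, b)"
    by (cases "quotient_of r")
  have b: "b > 0" and cop: "coprime a b" and r: "r = of_int a / of_int b"
    using quotient_of_denom_pos[OF ab] quotient_of_coprime[OF ab] quotient_of_div[OF ab] by auto
  have rq: "(of_rat r :: 'a) = of_int a / of_int b"
    by (simp add: r of_rat_divide)
  \<comment> \<open>If \<open>p\<close> divided \<open>b\<close>, coprimality would make
    \<open>a\<close> a unit, and the quotient would have absolute value above 1.\<close>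
  have pb: "\<not> int p dvd b"
  proof
    assume dvd: "int p dvd b"
    then have "\<not> int p dvd a"
      using cop prime_p p_gt_1 coprime_common_divisor[OF cop, of "int p"]
      by auto
    then have "absv (of_int a) = 1"
      by (rule absv_of_int_eq_1)
    moreover have "absv (of_int b) < 1"
      using absv_of_int_dvd_le[of 1 b] dvd p_gt_1 by (simp add: le_less_trans)
    moreover have "absv (of_int b) > 0"
      using b by (simp add: less_le)
    ultimately show False
      using assms(1) by (simp add: rq absv_divide)
  qed
  obtain N where N: "1 / real p ^ N < e"
    using p_power_inverse_less[OF assms(2)] .
  have "coprime b (int p ^ N)"
    using pb prime_p prime_imp_coprime[of "int p" b] by (simp add: coprime_commute)
  \<comment> \<open>With \<open>c\<close> an inverse of \<open>b\<close> modulo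
    \<open>p ^ N\<close>, the integer \<open>a * c\<close> approximates
    \<open>a / b\<close>.\<close>
  then obtain c where c: "[b * c = 1] (mod int p ^ N)"
    using cong_solve_coprime_int by blast
  then have dvd: "int p ^ N dvd a * (1 - b * c)"
    by (metis cong_iff_dvd_diff cong_sym dvd_mult)
  have "of_rat r - of_int (a * c) = of_int (a * (1 - b * c)) / (of_int b :: 'a)"
    using b by (simp add: rq field_simps)
  also have "absv \<dots> \<le> 1 / real p ^ N"
    using absv_of_int_dvd_le[OF dvd] absv_of_int_eq_1[OF pb] by (simp add: absv_divide)
  finally show ?thesis
    using N that by (meson le_less_trans)
qed

text \<open>The unit ball of the closure of the rationals is the closure of the integers. In this
  form, closure under subtraction and approximation by naturals are immediate.\<close>

lemma padic_integers_iff: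
  "x \<in> padic_integers absv \<longleftrightarrow> (\<forall>e>0. \<exists>i::int. absv (x - of_int i) < e)"
proof safe
  fix e :: real
  assume x: "x \<in> padic_integers absv" and "e > 0"
  \<comment> \<open>The bound 1 keeps the rational \<open>r\<close> in the unit ball; the bound
    \<open>e\<close> makes it close to \<open>x\<close>.\<close>
  then obtain r where r: "absv (of_rat r - x) < min 1 e"
    by (auto simp: padic_integers_def padic_numbers_def closure_approachable dist_absv
        dest!: spec[of _ "min 1 e"])
  moreover have "absv x \<le> 1"
    using x by (simp add: padic_integers_def)
  ultimately have "absv (of_rat r) \<le> 1"
    using absv_ultrametric[of "of_rat r - x" x] by (simp add: max_def split: if_splits)
  then obtain i where "absv (of_rat r - of_int i) < e"
    using rat_approx_by_int \<open>e > 0\<close> by blast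
  then have "absv (x - of_int i) < e"
    using r absv_ultrametric[of "x - of_rat r" "of_rat r - of_int i"]
      absv_minus_commute[of x "of_rat r"] by (simp add: max_def split: if_splits)
  then show "\<exists>i::int. absv (x - of_int i) < e"
    by blast
next
  assume *: "\<forall>e>0. \<exists>i::int. absv (x - of_int i) < e"
  have "x \<in> closure (range of_rat)"
    unfolding closure_approachable
  proof (intro allI impI)
    fix e :: real
    assume "e > 0"
    with * obtain i :: int where "absv (x - of_int i) < e"
      by blast
    then have "dist (of_rat (of_int i)) x < e"
      by (simp add: dist_absv absv_minus_commute)
    then show "\<exists>y\<in>range of_rat. dist y x < e"
      by blast
  qed
  moreover from * obtain i :: int where "absv (x - of_int i) < 1"
    by (meson zero_less_one)
  then have "absv x \<le> 1"
    using absv_ultrametric[of "x - of_int i" "of_int i"] absv_of_int_le_1[of i] by simp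
  ultimately show "x \<in> padic_integers absv"
    by (simp add: padic_integers_def padic_numbers_def)
qed

lemma of_int_padic_integers [simp]: "of_int i \<in> padic_integers absv"
  unfolding padic_integers_iff by (metis absv_0 diff_self)

lemma of_nat_padic_integers [simp]: "of_nat n \<in> padic_integers absv"
  using of_int_padic_integers[of "int n"] by simp

lemma diff_padic_integers:
  assumes "x \<in> padic_integers absv" and "y \<in> padic_integers absv"
  shows "x - y \<in> padic_integers absv"
  unfolding padic_integers_iff
proof (intro allI impI)
  fix e :: real
  assume "e > 0"
  with assms obtain i j :: int where "absv (x - of_int i) < e" "absv (y - of_int j) < e"
    unfolding padic_integers_iff by meson
  then have "absv (x - y - of_int (i - j)) < e"
    using absv_diff_le[of "x - of_int i" "y - of_int j"] by (simp add: algebra_simps)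
  then show "\<exists>i::int. absv (x - y - of_int i) < e"
    by blast
qed

lemma padic_integers_approx_by_nat:
  assumes "x \<in> padic_integers absv" and "e > 0"
  obtains n :: nat where "absv (x - of_nat n) < e"
proof -
  obtain i :: int where i: "absv (x - of_int i) < e"
    using assms unfolding padic_integers_iff by blast
  obtain N where N: "1 / real p ^ N < e"
    using p_power_inverse_less[OF assms(2)] .
  \<comment> \<open>Reduction modulo \<open>p ^ N\<close> makes the integer nonnegative and moves it
    by less than \<open>e\<close>.\<close>
  define n where "n = nat (i mod int p ^ N)"
  have n: "int n = i mod int p ^ N"
    using p_gt_1 by (simp add: n_def)
  have "int p ^ N dvd i - int n"
    unfolding n by (rule dvd_minus_mod)
  then have "absv (of_int (i - int n)) < e"
    using absv_of_int_dvd_le N le_less_trans by blast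
  then have "absv (x - of_nat n) < e"
    using i absv_ultrametric[of "x - of_int i" "of_int i - of_nat n"] by simp
  then show ?thesis
    by (rule that)
qed

section \<open>Binomial coefficients and the \<open>p\<close>-adic power function\<close>

text \<open>Written as products with a constant factor, the recursion carries both continuity and
  differentiability of binomial coefficients by induction on \<open>r\<close>.\<close>

lemma gbinomial_Suc_eq:
  "(x :: 'a) gchoose Suc r = inverse (of_nat (Suc r)) * ((x gchoose r) * (x - of_nat r))"
proof -
  have "of_nat (Suc r) * (x gchoose Suc r) = (x gchoose r) * (x - of_nat r)"
    using gbinomial_mult_1[of x r] by (simp add: algebra_simps)
  then have "(x gchoose Suc r) = (x gchoose r) * (x - of_nat r) / of_nat (Suc r)"
    by (metis nonzero_mult_div_cancel_left of_nat_neq_0)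
  then show ?thesis
    by (simp add: field_class.field_divide_inverse mult.commute)
qed

lemma tendsto_gbinomial:
  fixes f :: "'b \<Rightarrow> 'a"
  assumes "(f \<longlongrightarrow> l) F"
  shows "((\<lambda>x. f x gchoose r) \<longlongrightarrow> l gchoose r) F"
proof (induction r)
  case (Suc r)
  then show ?case
    unfolding gbinomial_Suc_eq
    by (intro tendsto_cmult_absv tendsto_mult_absv tendsto_diff_absv assms tendsto_const)
qed simp

text \<open>At naturals the binomial coefficient is a natural number, hence in the unit ball;
  density and continuity extend the bound.\<close>

lemma absv_gbinomial_le_1:
  assumes "x \<in> padic_integers absv"
  shows "absv (x gchoose r) \<le> 1"
proof -
  have "\<exists>m::nat. absv (x - of_nat m) < 1 / real (Suc n)" for n
    using padic_integers_approx_by_nat[OF assms, of "1 / real (Suc n)"] by auto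
  then obtain X :: "nat \<Rightarrow> nat" where X: "absv (x - of_nat (X n)) < 1 / real (Suc n)" for n
    by metis
  have "(\<lambda>n. of_nat (X n)) \<longlonglongrightarrow> x"
  proof (rule tendsto_absv_bound)
    show "(\<lambda>n. 1 / real (Suc n)) \<longlonglongrightarrow> 0"
      by (rule LIMSEQ_Suc[OF lim_1_over_n])
    show "\<forall>\<^sub>F n in sequentially. absv (of_nat (X n) - x) \<le> 1 / real (Suc n)"
      using X by (simp only: absv_minus_commute) (simp add: less_imp_le)
  qed
  then have "(\<lambda>n. of_nat (X n) gchoose r) \<longlonglongrightarrow> x gchoose r"
    by (rule tendsto_gbinomial)
  then show ?thesis
    using absv_limit_le[of "\<lambda>n. of_nat (X n) gchoose r" "x gchoose r" 0 0 1] absv_of_nat_le_1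
    by (simp flip: binomial_gbinomial)
qed

text \<open>Absorption writes the coefficient as \<open>x / k\<close> times
  \<open>x - 1 gchoose (k - 1)\<close>, where the last factor is bounded by 1 and
  \<open>1 / absv (of_nat k)\<close> by \<open>k\<close>.\<close>

lemma absv_gbinomial_le:
  assumes "x \<in> padic_integers absv" and "k > 0"
  shows "absv (x gchoose k) \<le> real k * absv x"
proof -
  have "x - 1 \<in> padic_integers absv"
    using diff_padic_integers[OF assms(1) of_nat_padic_integers[of 1]] by simp
  then have "absv (x - 1 gchoose (k - 1)) \<le> 1"
    by (rule absv_gbinomial_le_1)
  moreover have "inverse (absv (of_nat k)) \<le> real k"
    using le_imp_inverse_le[OF absv_of_nat_ge[OF assms(2)]] assms(2) by simp
  ultimately have
    "absv x * (inverse (absv (of_nat k)) * absv (x - 1 gchoose (k - 1))) \<le> absv x * (real k * 1)"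
    by (intro mult_left_mono mult_mono) auto
  then show ?thesis
    using gbinomial_absorption'[OF assms(2), of x]
    by (simp add: absv_mult absv_divide divide_real_def mult_ac)
qed

lemma absv_gbinomial_diff_le:
  assumes "x \<in> padic_integers absv" and "y \<in> padic_integers absv"
  shows "absv ((x gchoose r) - (y gchoose r)) \<le> real r * absv (x - y)"
proof -
  have "(x gchoose r) = (\<Sum>k=0..r. (x - y gchoose k) * (y gchoose (r - k)))"
    using gbinomial_Vandermonde[of "x - y" y r] by simp
  \<comment> \<open>The term with index 0 is the one to be subtracted; every other term contains a
    factor that is small with \<open>x - y\<close>.\<close>
  also have "\<dots> = (y gchoose r) + (\<Sum>k=Suc 0..r. (x - y gchoose k) * (y gchoose (r - k)))"
    by (simp add: sum.atLeast_Suc_atMost)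
  finally have "(x gchoose r) - (y gchoose r)
      = (\<Sum>k=Suc 0..r. (x - y gchoose k) * (y gchoose (r - k)))"
    by simp
  also have "absv \<dots> \<le> real r * absv (x - y)"
  proof (rule absv_sum_le)
    fix k
    assume k: "k \<in> {Suc 0..r}"
    have "absv (x - y gchoose k) \<le> real k * absv (x - y)"
      using k assms by (intro absv_gbinomial_le diff_padic_integers) auto
    also have "\<dots> \<le> real r * absv (x - y)"
      using k by (intro mult_right_mono) auto
    finally have "absv (x - y gchoose k) * absv (y gchoose (r - k)) \<le> real r * absv (x - y) * 1"
      using absv_gbinomial_le_1[OF assms(2)] by (intro mult_mono) auto
    then show "absv ((x - y gchoose k) * (y gchoose (r - k))) \<le> real r * absv (x - y)"
      by (simp add: absv_mult)
  qed simp
  finally show ?thesis .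
qed

text \<open>The binomial coefficients are bounded by 1, so a geometric sequence dominates the terms.
  This certifies that the infinite sum in \<open>padic_power\<close> is a genuine limit.\<close>

lemma padic_power_sums:
  assumes "absv (u - 1) < 1" and "x \<in> padic_integers absv"
  shows "(\<lambda>r. (x gchoose r) * (u - 1) ^ r) sums padic_power u x"
proof -
  have "(\<lambda>r. absv ((x gchoose r) * (u - 1) ^ r)) \<longlonglongrightarrow> 0"
  proof (rule tendsto_sandwich[OF _ _ tendsto_const])
    show "(\<lambda>r. absv (u - 1) ^ r) \<longlonglongrightarrow> 0"
      using assms(1) by (intro LIMSEQ_power_zero) simp
    show "\<forall>\<^sub>F r in sequentially. absv ((x gchoose r) * (u - 1) ^ r) \<le> absv (u - 1) ^ r"
      using absv_gbinomial_le_1[OF assms(2)] by (simp add: absv_mult mult_left_le_one_le)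
  qed simp
  then show ?thesis
    unfolding padic_power_def by (intro summable_sums summable_absv)
qed

text \<open>The series terminates at a natural exponent, so the binomial theorem applies for every
  base \<open>u\<close>.\<close>

lemma padic_power_of_nat: "padic_power u (of_nat n :: 'a) = u ^ n"
proof -
  have "(\<lambda>r. (of_nat n gchoose r) * (u - 1) ^ r) sums
      (\<Sum>r\<le>n. (of_nat n gchoose r) * (u - 1) ^ r)"
    by (rule sums_finite) (auto simp flip: binomial_gbinomial)
  moreover have "(\<Sum>r\<le>n. (of_nat n gchoose r) * (u - 1) ^ r) = u ^ n"
    using binomial_ring[of "u - 1" 1 n] by (simp flip: binomial_gbinomial)
  ultimately show ?thesis
    unfolding padic_power_def by (simp add: sums_iff)
qed

text \<open>Each term from index \<open>R\<close> on is at most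
  \<open>r * absv (u - 1) ^ r * absv (x - y)\<close>, and the bound passes to the limit. Taking
  \<open>R = 0\<close> gives a Lipschitz estimate; a large \<open>R\<close> makes the tail of the
  difference quotient small.\<close>

lemma padic_power_diff_tail:
  assumes "absv (u - 1) < 1" and "x \<in> padic_integers absv" and "y \<in> padic_integers absv"
    and B: "\<And>r. r \<ge> R \<Longrightarrow> real r * absv (u - 1) ^ r \<le> B" "B \<ge> 0"
  shows "absv ((padic_power u x - padic_power u y)
      - (\<Sum>r<R. ((x gchoose r) - (y gchoose r)) * (u - 1) ^ r)) \<le> B * absv (x - y)"
proof (rule absv_limit_le)
  let ?X = "\<lambda>n. \<Sum>r<n. ((x gchoose r) - (y gchoose r)) * (u - 1) ^ r"
  have "(\<lambda>n. (\<Sum>r<n. (x gchoose r) * (u - 1) ^ r) - (\<Sum>r<n. (y gchoose r) * (u - 1) ^ r))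
      \<longlonglongrightarrow> padic_power u x - padic_power u y"
    using padic_power_sums[OF assms(1,2)] padic_power_sums[OF assms(1,3)]
    unfolding sums_def by (rule tendsto_diff_absv)
  then show "?X \<longlonglongrightarrow> padic_power u x - padic_power u y"
    by (simp add: sum_subtractf left_diff_distrib)
  fix n
  assume "n \<ge> R"
  then have "?X n - ?X R = (\<Sum>r=R..<n. ((x gchoose r) - (y gchoose r)) * (u - 1) ^ r)"
    by (simp add: lessThan_atLeast0 sum_diff_nat_ivl)
  also have "absv \<dots> \<le> B * absv (x - y)"
  proof (rule absv_sum_le)
    fix r
    assume r: "r \<in> {R..<n}"
    have "absv (((x gchoose r) - (y gchoose r)) * (u - 1) ^ r)
        \<le> (real r * absv (x - y)) * absv (u - 1) ^ r"
      using absv_gbinomial_diff_le[OF assms(2,3)] by (simp add: absv_mult mult_right_mono)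
    also have "\<dots> = (real r * absv (u - 1) ^ r) * absv (x - y)"
      by simp
    also have "\<dots> \<le> B * absv (x - y)"
      using r B by (intro mult_right_mono) auto
    finally show "absv (((x gchoose r) - (y gchoose r)) * (u - 1) ^ r) \<le> B * absv (x - y)" .
  qed (use B in simp)
  finally show "absv (?X n - ?X R) \<le> B * absv (x - y)" .
qed

lemma times_power_absv_tendsto_0:
  assumes "absv h < 1"
  shows "(\<lambda>r. real r * absv h ^ r) \<longlonglongrightarrow> 0"
  using powser_times_n_limit_0[of "absv h"] assms by simp

lemma padic_power_lipschitz:
  assumes "absv (u - 1) < 1"
  obtains C where "C \<ge> 0" and "\<And>x y. x \<in> padic_integers absv \<Longrightarrow> y \<in> padic_integers absv \<Longrightarrow>
    absv (padic_power u x - padic_power u y) \<le> C * absv (x - y)"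
proof -
  have "Bseq (\<lambda>r. real r * absv (u - 1) ^ r)"
    using times_power_absv_tendsto_0[OF assms] by (intro convergent_imp_Bseq convergentI)
  then obtain C where C: "C > 0" "norm (real r * absv (u - 1) ^ r) \<le> C" for r
    by (auto elim: BseqE)
  then have "real r * absv (u - 1) ^ r \<le> C" for r
    using C(2)[of r] by (simp add: abs_mult)
  then show ?thesis
    using that[of C] C(1) padic_power_diff_tail[OF assms, of _ _ 0 C] by simp
qed

section \<open>Uniform differentiability\<close>

text \<open>This is the filter in the definition of uniform differentiability; naming it allows
  limit rules to be applied to it.\<close>

definition diagonal_filter :: "'a \<Rightarrow> ('a \<times> 'a) filter" where
  "diagonal_filter a =
     at (a, a) within {(x, y). x \<in> padic_integers absv \<and> y \<in> padic_integers absv \<and> x \<noteq> y}"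

text \<open>The limits along both coordinates are carried along because the product rule needs the
  one of \<open>f x\<close> and the one of \<open>g y\<close>.\<close>

definition strictly_differentiable :: "('a \<Rightarrow> 'a) \<Rightarrow> 'a \<Rightarrow> bool" where
  "strictly_differentiable f a \<longleftrightarrow>
     ((\<lambda>z. f (fst z)) \<longlongrightarrow> f a) (diagonal_filter a) \<and>
     ((\<lambda>z. f (snd z)) \<longlongrightarrow> f a) (diagonal_filter a) \<and>
     (\<exists>l. ((\<lambda>(x, y). (f x - f y) / (x - y)) \<longlongrightarrow> l) (diagonal_filter a))"

lemma eventually_diagonal_filter:
  "\<forall>\<^sub>F z in diagonal_filter a.
     fst z \<in> padic_integers absv \<and> snd z \<in> padic_integers absv \<and> fst z \<noteq> snd z"
  unfolding diagonal_filter_def eventually_at_filter by (auto intro: always_eventually)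

lemma tendsto_fst_diagonal: "(fst \<longlongrightarrow> a) (diagonal_filter a)"
  unfolding diagonal_filter_def
  using tendsto_fst[OF tendsto_ident_at[of "(a, a)"]] by simp

lemma tendsto_snd_diagonal: "(snd \<longlongrightarrow> a) (diagonal_filter a)"
  unfolding diagonal_filter_def
  using tendsto_snd[OF tendsto_ident_at[of "(a, a)"]] by simp

lemma strictly_differentiable_const: "strictly_differentiable (\<lambda>_. c) a"
  unfolding strictly_differentiable_def by (auto intro!: exI[of _ 0] simp: case_prod_unfold)

lemma strictly_differentiable_ident: "strictly_differentiable (\<lambda>x. x) a"
proof -
  \<comment> \<open>The quotient is 1 only off the diagonal, since division by 0 yields 0; the
    filter eventually avoids the diagonal.\<close>
  have "((\<lambda>(x, y). (x - y) / (x - y)) \<longlongrightarrow> 1) (diagonal_filter a)"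
    by (rule tendsto_eventually, rule eventually_mono[OF eventually_diagonal_filter]) auto
  then show ?thesis
    unfolding strictly_differentiable_def using tendsto_fst_diagonal tendsto_snd_diagonal by blast
qed

lemma strictly_differentiable_add:
  assumes "strictly_differentiable f a" and "strictly_differentiable g a"
  shows "strictly_differentiable (\<lambda>x. f x + g x) a"
proof -
  obtain l m where
    "((\<lambda>(x, y). (f x - f y) / (x - y)) \<longlongrightarrow> l) (diagonal_filter a)"
    "((\<lambda>(x, y). (g x - g y) / (x - y)) \<longlongrightarrow> m) (diagonal_filter a)"
    using assms unfolding strictly_differentiable_def by blast
  from tendsto_add_absv[OF this]
  have "((\<lambda>(x, y). (f x + g x - (f y + g y)) / (x - y)) \<longlongrightarrow> l + m) (diagonal_filter a)"
    by (simp add: case_prod_unfold add_diff_add add_divide_distrib)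
  then show ?thesis
    using assms unfolding strictly_differentiable_def
    by (intro conjI exI[of _ "l + m"]) (auto intro: tendsto_add_absv)
qed

lemma strictly_differentiable_mult:
  assumes "strictly_differentiable f a" and "strictly_differentiable g a"
  shows "strictly_differentiable (\<lambda>x. f x * g x) a"
proof -
  obtain l m where
    l: "((\<lambda>(x, y). (f x - f y) / (x - y)) \<longlongrightarrow> l) (diagonal_filter a)" and
    m: "((\<lambda>(x, y). (g x - g y) / (x - y)) \<longlongrightarrow> m) (diagonal_filter a)"
    using assms unfolding strictly_differentiable_def by blast
  have f: "((\<lambda>z. f (fst z)) \<longlongrightarrow> f a) (diagonal_filter a)"
    and g: "((\<lambda>z. g (snd z)) \<longlongrightarrow> g a) (diagonal_filter a)"
    using assms unfolding strictly_differentiable_def by blast+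
  \<comment> \<open>This discrete Leibniz rule holds also for \<open>x = y\<close>, where both sides
    are 0.\<close>
  have "f x * ((g x - g y) / (x - y)) + g y * ((f x - f y) / (x - y))
      = (f x * g x - f y * g y) / (x - y)" for x y
    by (simp add: add_divide_distrib[symmetric] algebra_simps)
  with tendsto_add_absv[OF tendsto_mult_absv[OF f m] tendsto_mult_absv[OF g l]]
  have "((\<lambda>(x, y). (f x * g x - f y * g y) / (x - y)) \<longlongrightarrow> f a * m + g a * l)
      (diagonal_filter a)"
    by (simp add: case_prod_unfold)
  then show ?thesis
    using assms unfolding strictly_differentiable_def
    by (intro conjI exI[of _ "f a * m + g a * l"]) (auto intro: tendsto_mult_absv)
qed

lemma strictly_differentiable_diff:
  assumes "strictly_differentiable f a" and "strictly_differentiable g a"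
  shows "strictly_differentiable (\<lambda>x. f x - g x) a"
  using strictly_differentiable_add[OF assms(1)
      strictly_differentiable_mult[OF strictly_differentiable_const[of "-1"] assms(2)]]
  by simp

lemma strictly_differentiable_power:
  "strictly_differentiable f a \<Longrightarrow> strictly_differentiable (\<lambda>x. f x ^ n) a"
  by (induction n) (auto intro: strictly_differentiable_const strictly_differentiable_mult)

lemma strictly_differentiable_sum:
  assumes "\<And>i. i \<in> A \<Longrightarrow> strictly_differentiable (f i) a"
  shows "strictly_differentiable (\<lambda>x. \<Sum>i\<in>A. f i x) a"
  using assms
  by (induction A rule: infinite_finite_induct)
     (auto intro: strictly_differentiable_const strictly_differentiable_add)

lemma strictly_differentiable_gbinomial: "strictly_differentiable (\<lambda>x. x gchoose r) a"
proof (induction r)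
  case 0
  then show ?case
    by (simp add: strictly_differentiable_const)
next
  case (Suc r)
  then show ?case
    unfolding gbinomial_Suc_eq
    by (intro strictly_differentiable_mult strictly_differentiable_diff
        strictly_differentiable_const strictly_differentiable_ident)
qed

text \<open>The difference quotient of the tail of the binomial series is uniformly small, so the
  difference quotients of the power function form a Cauchy filter because those of the partial
  sums converge.\<close>

lemma strictly_differentiable_padic_power:
  assumes u: "absv (u - 1) < 1" and a: "a \<in> padic_integers absv"
  shows "strictly_differentiable (padic_power u) a"
proof -
  let ?F = "diagonal_filter a"
  let ?Q = "\<lambda>(x, y). (padic_power u x - padic_power u y) / (x - y)"
  obtain C where C: "C \<ge> 0" "\<And>x y. x \<in> padic_integers absv \<Longrightarrow> y \<in> padic_integers absv \<Longrightarrow>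
      absv (padic_power u x - padic_power u y) \<le> C * absv (x - y)"
    using padic_power_lipschitz[OF u] by blast
  have lim: "((\<lambda>z. padic_power u (g z)) \<longlongrightarrow> padic_power u a) ?F"
    if "(g \<longlongrightarrow> a) ?F" and "\<forall>\<^sub>F z in ?F. g z \<in> padic_integers absv" for g
  proof (rule tendsto_absv_bound)
    show "((\<lambda>z. C * absv (g z - a)) \<longlongrightarrow> 0) ?F"
      using that(1) unfolding tendsto_absv_iff by (rule tendsto_mult_right_zero)
    show "\<forall>\<^sub>F z in ?F. absv (padic_power u (g z) - padic_power u a) \<le> C * absv (g z - a)"
      using that(2) by (rule eventually_mono) (rule C(2)[OF _ a])
  qed
  have fst: "((\<lambda>z. padic_power u (fst z)) \<longlongrightarrow> padic_power u a) ?F"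
    by (rule lim[OF tendsto_fst_diagonal], rule eventually_mono[OF eventually_diagonal_filter]) simp
  have snd: "((\<lambda>z. padic_power u (snd z)) \<longlongrightarrow> padic_power u a) ?F"
    by (rule lim[OF tendsto_snd_diagonal], rule eventually_mono[OF eventually_diagonal_filter]) simp
  have "cauchy_filter (filtermap ?Q ?F)"
    unfolding cauchy_filter_metric_filtermap
  proof (intro allI impI)
    fix e :: real
    assume e: "e > 0"
    \<comment> \<open>Beyond this index the series contributes at most \<open>e / 2\<close> to the
      difference quotient.\<close>
    then obtain R where R: "real r * absv (u - 1) ^ r < e / 2" if "r \<ge> R" for r
      using order_tendstoD(2)[OF times_power_absv_tendsto_0[OF u], of "e / 2"]
      by (auto simp: eventually_sequentially)
    let ?f = "\<lambda>x. \<Sum>r<R. (x gchoose r) * (u - 1) ^ r"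
    have "strictly_differentiable ?f a"
      by (intro strictly_differentiable_sum strictly_differentiable_mult
          strictly_differentiable_gbinomial strictly_differentiable_const)
    then obtain l where "((\<lambda>(x, y). (?f x - ?f y) / (x - y)) \<longlongrightarrow> l) ?F"
      unfolding strictly_differentiable_def by blast
    then have l: "\<forall>\<^sub>F (x, y) in ?F. absv ((?f x - ?f y) / (x - y) - l) < e"
      using e by (simp add: tendsto_iff dist_absv case_prod_unfold)
    define P where "P = (\<lambda>z. absv (?Q z - l) < e)"
    have "\<forall>\<^sub>F z in ?F. P z"
      using l eventually_diagonal_filter
    proof eventually_elim
      case (elim z)
      obtain x y where z: "z = (x, y)"
        by (cases z)
      have "absv ((padic_power u x - padic_power u y) - (?f x - ?f y)) \<le> e / 2 * absv (x - y)"
        using padic_power_diff_tail[OF u, of x y R "e / 2"] elim R e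
        by (simp add: z less_imp_le sum_subtractf left_diff_distrib)
      then have "absv (((padic_power u x - padic_power u y) - (?f x - ?f y)) / (x - y)) \<le> e / 2"
        using elim by (simp add: z absv_divide divide_le_eq less_le)
      then have "absv (?Q z - (?f x - ?f y) / (x - y)) < e"
        using e by (simp add: z diff_divide_distrib)
      then show ?case
        using elim absv_ultrametric[of "?Q z - (?f x - ?f y) / (x - y)" "(?f x - ?f y) / (x - y) - l"]
        by (simp add: P_def z)
    qed
    moreover have "dist (?Q z) (?Q w) < e" if "P z" "P w" for z w
      using that absv_diff_le[of "?Q z - l" "?Q w - l"] by (simp add: P_def dist_absv)
    ultimately show "\<exists>P. eventually P ?F \<and> (\<forall>z w. P z \<and> P w \<longrightarrow> dist (?Q z) (?Q w) < e)"
      by blast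
  qed
  then have "\<exists>l. (?Q \<longlongrightarrow> l) ?F"
    \<comment> \<open>Completeness yields a limit for a nontrivial filter; for the trivial filter
      every point is one.\<close>
    using cauchy_filter_complete_converges[OF _ complete_UNIV, of "filtermap ?Q ?F"]
    by (cases "?F = bot") (auto simp: filterlim_def filtermap_bot_iff)
  with fst snd show ?thesis
    unfolding strictly_differentiable_def by blast
qed

section \<open>The integrals\<close>

text \<open>If \<open>q = -1\<close>, then \<open>1 - q\<close> is 2, a unit since \<open>p\<close>
  is odd. The value \<open>q + 1\<close> is the constant term of the generating function's
  denominator and the leading coefficient of the recurrence for the integrals.\<close>

lemma q_plus_1_neq_0:
  assumes "odd p" and "absv (1 - q) < 1"
  shows "q + 1 \<noteq> 0"
proof
  assume "q + 1 = 0"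
  then have "q = -1"
    by (simp only: eq_neg_iff_add_eq_0)
  then have "1 - q = of_int 2"
    by simp
  moreover have "\<not> int p dvd 2"
  proof
    assume "int p dvd 2"
    then have "p \<le> 2"
      using zdvd_imp_le[of "int p" 2] by simp
    with p_gt_1 have "p = 2"
      by simp
    with assms(1) show False
      by simp
  qed
  ultimately show False
    using assms(2) absv_of_int_eq_1[of 2] by (metis less_irrefl)
qed

text \<open>Coefficients are compared in \<open>D * (q e^t + 1) = 2\<close>, where \<open>D\<close>
  is the generating function; multiplication by \<open>fact n\<close> turns the product with the
  exponential into a binomial convolution.\<close>

lemma q_euler_rec:
  fixes q :: 'a
  assumes "q + 1 \<noteq> 0"
  shows "q * (\<Sum>i\<le>n. of_nat (n choose i) * q_euler q i) + q_euler q n = (if n = 0 then 2 else 0)"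
proof -
  let ?g = "fps_const q * fps_exp 1 + 1 :: 'a fps"
  define D where "D = fps_const 2 / ?g"
  have g0: "?g $ 0 \<noteq> 0"
    using assms by simp
  have E: "q_euler q i = fact i * D $ i" for i
    by (simp add: q_euler_def D_def)
  have "D * ?g = fps_const 2"
    using g0 by (simp add: D_def fps_divide_unit mult.assoc inverse_mult_eq_1)
  moreover have "D * ?g = fps_const q * (D * fps_exp 1) + D"
    by (simp add: algebra_simps)
  ultimately have "fact n * (fps_const q * (D * fps_exp 1) + D) $ n = (if n = 0 then 2 else 0)"
    by simp
  moreover have "fact n * (D * fps_exp 1) $ n = (\<Sum>i\<le>n. of_nat (n choose i) * q_euler q i)"
    by (auto simp: fps_mult_nth E sum_distrib_left atLeast0AtMost binomial_fact intro!: sum.cong)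
  moreover have "fact n * (fps_const q * (D * fps_exp 1)) $ n = q * (fact n * (D * fps_exp 1) $ n)"
    by simp
  ultimately show ?thesis
    by (simp only: E distrib_left fps_add_nth)
qed

section \<open>Alternating sums and the limits of the basic integrals\<close>

lemma alternating_telescope:
  fixes G :: "nat \<Rightarrow> 'b::comm_ring_1"
  shows "(\<Sum>x<M. (G (Suc x) + G x) * (-1) ^ x) = G 0 - (-1) ^ M * G M"
  by (induction M) (simp_all add: algebra_simps)

text \<open>As \<open>p ^ N\<close> is odd, the upper boundary term of the telescoping sum enters
  with a plus sign and contributes a second \<open>G 0\<close> in the limit.\<close>

lemma fermionic_sum_shift:
  fixes G :: "'a \<Rightarrow> 'a"
  assumes "odd p" and "(\<lambda>N. G (of_nat (p ^ N))) \<longlonglongrightarrow> G 0"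
  shows "(\<lambda>N. \<Sum>x<p ^ N. (G (of_nat x + 1) + G (of_nat x)) * (-1) ^ x) \<longlonglongrightarrow> 2 * G 0"
proof -
  have "(\<Sum>x<p ^ N. (G (of_nat x + 1) + G (of_nat x)) * (-1) ^ x) = G 0 + G (of_nat (p ^ N))" for N
    using alternating_telescope[of "\<lambda>x. G (of_nat x)" "p ^ N"] assms(1)
    by (simp add: add.commute[of 1])
  then show ?thesis
    using tendsto_add_absv[OF tendsto_const[of "G 0"] assms(2)] unfolding mult_2 by (simp only:)
qed

lemma absv_inverse_minus_1:
  assumes "absv (1 - q) < 1"
  shows "q \<noteq> 0" and "absv (inverse q - 1) < 1"
proof -
  show "q \<noteq> 0"
    using assms by auto
  \<comment> \<open>Otherwise \<open>1 = (1 - q) + q\<close> would be a sum of two elements of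
    absolute value below 1.\<close>
  have "absv q \<ge> 1"
  proof (rule ccontr)
    assume "\<not> absv q \<ge> 1"
    then show False
      using absv_ultrametric[of "1 - q" q] assms by simp
  qed
  moreover have "inverse q - 1 = (1 - q) / q"
    using \<open>q \<noteq> 0\<close> by (simp add: diff_divide_distrib inverse_eq_divide)
  ultimately show "absv (inverse q - 1) < 1"
    using assms by (simp add: absv_divide divide_less_eq)
qed

lemma p_power_tendsto_0: "(\<lambda>N. of_nat (p ^ N) :: 'a) \<longlonglongrightarrow> 0"
proof (rule tendsto_absv_bound)
  show "(\<lambda>N. (1 / real p) ^ N) \<longlonglongrightarrow> 0"
    using p_gt_1 by (intro LIMSEQ_power_zero) simp
qed (simp add: absv_p)

text \<open>Telescoping \<open>G x = (2 - x) ^ n * q ^ (2 - x)\<close> and expanding \<open>2 - x = 1 + (1 - x)\<close> shows that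
  the limits satisfy a recurrence with the leading coefficient \<open>q + 1\<close>, which is the one
  satisfied by the right-hand side.\<close>

lemma fermionic_limit:
  assumes "odd p" and q: "absv (1 - q) < 1"
  shows "(\<lambda>N. \<Sum>x<p ^ N. (1 - of_nat x) ^ n * padic_power_one_minus q (of_nat x) * (-1) ^ x)
    \<longlonglongrightarrow> 2 * q + q_euler q n - (if n = 0 then 2 else 0)"
proof (induction n rule: less_induct)
  case (less n)
  let ?w = "padic_power_one_minus q"
  define T where "T = (\<lambda>i N. \<Sum>x<p ^ N. (1 - of_nat x) ^ i * ?w (of_nat x) * (-1) ^ x)"
  \<comment> \<open>At index 0 the value is \<open>2 * q ^ 2 / (q + 1)\<close>, since the Euler
    number there is \<open>2 / (q + 1)\<close>; hence the correction by 2.\<close>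
  define A where "A = (\<lambda>i. 2 * q + q_euler q i - (if i = 0 then 2 else 0))"
  \<comment> \<open>The factor \<open>q * ?w x\<close> plays the role of \<open>q ^ (2 - x)\<close>,
    so that \<open>G (x + 1)\<close> is the integrand at \<open>x\<close>.\<close>
  define G where "G = (\<lambda>x. (2 - x) ^ n * (q * ?w x))"
  note q0 = absv_inverse_minus_1(1)[OF q] and u = absv_inverse_minus_1(2)[OF q]
  have w_Suc: "q * ?w (of_nat x + 1) = ?w (of_nat x)" for x
    using padic_power_of_nat[of "inverse q" "Suc x"] padic_power_of_nat[of "inverse q" x] q0
    by (simp add: padic_power_one_minus_def add.commute)
  have w0: "?w 0 = q"
    using padic_power_of_nat[of "inverse q" 0] by (simp add: padic_power_one_minus_def)
  have "(\<lambda>N. padic_power (inverse q) (of_nat (p ^ N))) \<longlonglongrightarrow> padic_power (inverse q) 0"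
  proof -
    obtain C where C: "C \<ge> 0" "\<And>x y. x \<in> padic_integers absv \<Longrightarrow> y \<in> padic_integers absv \<Longrightarrow>
        absv (padic_power (inverse q) x - padic_power (inverse q) y) \<le> C * absv (x - y)"
      using padic_power_lipschitz[OF u] by blast
    show ?thesis
    proof (rule tendsto_absv_bound)
      show "(\<lambda>N. C * absv (of_nat (p ^ N) - 0)) \<longlonglongrightarrow> 0"
        using p_power_tendsto_0 unfolding tendsto_absv_iff by (rule tendsto_mult_right_zero)
      show "\<forall>\<^sub>F N in sequentially. absv (padic_power (inverse q) (of_nat (p ^ N))
          - padic_power (inverse q) 0) \<le> C * absv (of_nat (p ^ N) - 0)"
        using C(2)[OF of_nat_padic_integers of_nat_padic_integers[of 0]]
        by (intro always_eventually allI) (simp only: of_nat_0)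
    qed
  qed
  then have "(\<lambda>N. G (of_nat (p ^ N))) \<longlonglongrightarrow> G 0"
    unfolding G_def padic_power_one_minus_def
    by (intro tendsto_mult_absv tendsto_power_absv tendsto_diff_absv tendsto_const p_power_tendsto_0)
  then have lim: "(\<lambda>N. \<Sum>x<p ^ N. (G (of_nat x + 1) + G (of_nat x)) * (-1) ^ x)
      \<longlonglongrightarrow> 2 * (2 ^ n * (q * q))"
    using fermionic_sum_shift[OF assms(1), of G] by (simp add: G_def w0)
  \<comment> \<open>The shifted term contributes 1 and the top term of the expansion of
    \<open>(2 - x) ^ n\<close> contributes \<open>q\<close>; together they give the coefficient
    \<open>q + 1\<close>.\<close>
  have G_sum: "G (of_nat x + 1) + G (of_nat x) = (q + 1) * ((1 - of_nat x) ^ n * ?w (of_nat x))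
      + q * (\<Sum>i<n. of_nat (n choose i) * ((1 - of_nat x) ^ i * ?w (of_nat x)))" for x
  proof -
    have "G (of_nat x + 1) = (1 - of_nat x) ^ n * ?w (of_nat x)"
      by (simp add: G_def w_Suc)
    moreover have "(2 - of_nat x :: 'a) ^ n = (\<Sum>i\<le>n. of_nat (n choose i) * (1 - of_nat x) ^ i)"
      using binomial_ring[of "1 - of_nat x :: 'a" 1 n] by simp
    ultimately show ?thesis
      by (simp add: G_def lessThan_Suc_atMost[symmetric] sum_distrib_left sum_distrib_right
          algebra_simps)
  qed
  have "(\<Sum>x<p ^ N. (G (of_nat x + 1) + G (of_nat x)) * (-1) ^ x)
      = (q + 1) * T n N + q * (\<Sum>i<n. of_nat (n choose i) * T i N)" for N
    unfolding G_sum T_def sum_distrib_left sum_distrib_right distrib_right sum.distrib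
    by (subst (2) sum.swap) (simp add: mult_ac)
  with lim have lim': "(\<lambda>N. (q + 1) * T n N + q * (\<Sum>i<n. of_nat (n choose i) * T i N))
      \<longlonglongrightarrow> 2 * (2 ^ n * (q * q))"
    by simp
  have IH: "T i \<longlonglongrightarrow> A i" if "i < n" for i
    using less[OF that] by (simp add: T_def A_def)
  have "(\<lambda>N. q * (\<Sum>i<n. of_nat (n choose i) * T i N))
      \<longlonglongrightarrow> q * (\<Sum>i<n. of_nat (n choose i) * A i)"
    by (intro tendsto_cmult_absv tendsto_sum_absv) (auto intro: IH)
  \<comment> \<open>Solving for \<open>T n\<close> both proves that its limit exists and determines
    it.\<close>
  from tendsto_cmult_absv[OF tendsto_diff_absv[OF lim' this], of "inverse (q + 1)"]
  have "T n \<longlonglongrightarrow> inverse (q + 1) *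
      (2 * (2 ^ n * (q * q)) - q * (\<Sum>i<n. of_nat (n choose i) * A i))"
    using q_plus_1_neq_0[OF assms] by (simp add: mult.assoc[symmetric])
  moreover have "2 * (2 ^ n * (q * q)) = (q + 1) * A n + q * (\<Sum>i<n. of_nat (n choose i) * A i)"
  proof -
    have pow2: "(\<Sum>i\<le>n. of_nat (n choose i)) = (2 ^ n :: 'a)"
      using binomial_ring[of "1 :: 'a" 1 n] by simp
    have at0: "(\<Sum>i\<le>n. of_nat (n choose i) * (if i = 0 then 2 else 0)) = (2 :: 'a)"
      by (simp add: if_distrib sum.delta cong: if_cong)
    have "(\<Sum>i\<le>n. of_nat (n choose i) * A i)
        = 2 * q * 2 ^ n + (\<Sum>i\<le>n. of_nat (n choose i) * q_euler q i) - 2"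
      unfolding A_def pow2[symmetric]
      by (subst at0[symmetric]) (simp add: sum_distrib_left sum.distrib sum_subtractf algebra_simps)
    \<comment> \<open>The correction in \<open>A n\<close> is the right-hand side of the Euler
      recurrence, so substituting the left-hand side cancels \<open>q_euler q n\<close>.\<close>
    moreover have "A n = 2 * q - q * (\<Sum>i\<le>n. of_nat (n choose i) * q_euler q i)"
      unfolding A_def q_euler_rec[OF q_plus_1_neq_0[OF assms], of n, symmetric] by simp
    ultimately have "q * (\<Sum>i\<le>n. of_nat (n choose i) * A i) + A n = 2 * (2 ^ n * (q * q))"
      by (simp only:) (simp add: algebra_simps)
    then show ?thesis
      by (simp add: lessThan_Suc_atMost[symmetric] algebra_simps)
  qed
  ultimately have "T n \<longlonglongrightarrow> A n"
    using q_plus_1_neq_0[OF assms] by (simp add: mult.assoc[symmetric])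
  then show ?case
    by (simp add: T_def A_def)
qed

section \<open>Products of Bernstein polynomials in powers of \<open>1 - x\<close>\<close>

lemma bernstein_poly_mult_eq:
  fixes x :: 'a
  assumes "m + n > 2 * k"
  shows "bernstein_poly k n x * bernstein_poly k m x =
    of_nat (n choose k) * of_nat (m choose k) *
      (\<Sum>j\<le>2 * k. of_nat (2 * k choose j) * (-1) ^ (j + 2 * k) * (1 - x) ^ (n + m - j))"
proof (cases "k \<le> n \<and> k \<le> m")
  case True
  \<comment> \<open>The even exponent permits the change of sign, which attaches
    \<open>(-1) ^ j\<close> to the power \<open>2 * k - j\<close> of \<open>1 - x\<close>.\<close>
  have "x ^ (2 * k) = (-1 + (1 - x)) ^ (2 * k)"
    by (simp add: power_mult)
  also have "\<dots> = (\<Sum>j\<le>2 * k. of_nat (2 * k choose j) * (-1) ^ j * (1 - x) ^ (2 * k - j))"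
    by (rule binomial_ring)
  finally have "x ^ (2 * k) * (1 - x) ^ (n + m - 2 * k) = (\<Sum>j\<le>2 * k. of_nat (2 * k choose j) *
      (-1) ^ (j + 2 * k) * ((1 - x) ^ (2 * k - j) * (1 - x) ^ (n + m - 2 * k)))"
    by (simp only: sum_distrib_right) (auto simp: power_add mult_ac intro!: sum.cong)
  \<comment> \<open>Since \<open>2 * k < m + n\<close>, the truncated subtractions are exact and the
    exponents add up to \<open>n + m - j\<close>.\<close>
  also have "\<dots> = (\<Sum>j\<le>2 * k. of_nat (2 * k choose j) * (-1) ^ (j + 2 * k) * (1 - x) ^ (n + m - j))"
    using assms by (intro sum.cong) (auto simp flip: power_add)
  finally have "\<dots> = x ^ (2 * k) * (1 - x) ^ (n + m - 2 * k)" ..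
  moreover have "x ^ (2 * k) = x ^ k * x ^ k"
    by (simp add: mult_2 power_add)
  moreover have "(1 - x) ^ (n + m - 2 * k) = (1 - x) ^ (n - k) * (1 - x) ^ (m - k)"
    using True by (simp add: mult_2 flip: power_add)
  ultimately show ?thesis
    by (simp add: bernstein_poly_def mult_ac)
\<comment> \<open>If \<open>k\<close> exceeds \<open>n\<close> or \<open>m\<close>, a vanishing
  binomial coefficient makes both sides 0.\<close>
qed (auto simp: bernstein_poly_def)

end

theorem theorem6:
  fixes p :: nat
    and absv :: "'a::{field_char_0, complete_space} \<Rightarrow> real"
    and q :: 'a
    and m n k :: nat
  assumes "padic_complex_field p absv"
    and "odd p"
    and "absv (1 - q) < 1"
    and "m + n > 2 * k"
  shows "has_fermionic_integral p absv
           (\<lambda>x. bernstein_poly k n x * bernstein_poly k m x * padic_power_one_minus q x)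
           (if k = 0 then 2 * q + q_euler q (n + m)
            else of_nat (n choose k) * of_nat (m choose k) *
              (\<Sum>j=0..2 * k. of_nat ((2 * k) choose j) * (-1) ^ (j + 2 * k) *
                 q_euler q (n + m - j)))"
proof -
  interpret padic_complex_field p absv
    by fact
  let ?f = "\<lambda>x. bernstein_poly k n x * bernstein_poly k m x * padic_power_one_minus q x"
  let ?c = "of_nat (n choose k) * of_nat (m choose k) :: 'a"
  let ?b = "\<lambda>j. of_nat (2 * k choose j) * (-1) ^ (j + 2 * k) :: 'a"
  let ?T = "\<lambda>i N. \<Sum>x<p ^ N. (1 - of_nat x) ^ i * padic_power_one_minus q (of_nat x) * (-1) ^ x"
  have "strictly_differentiable ?f a" if "a \<in> padic_integers absv" for a
    unfolding bernstein_poly_def padic_power_one_minus_def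
    by (intro strictly_differentiable_mult strictly_differentiable_power
        strictly_differentiable_diff strictly_differentiable_const strictly_differentiable_ident
        strictly_differentiable_padic_power absv_inverse_minus_1(2) assms that)
  then have "uniformly_differentiable_on ?f (padic_integers absv)"
    unfolding uniformly_differentiable_on_def strictly_differentiable_def diagonal_filter_def
    by blast
  moreover have "(\<lambda>N. \<Sum>x<p ^ N. ?f (of_nat x) * (-1) ^ x)
      \<longlonglongrightarrow> ?c * (\<Sum>j\<le>2 * k. ?b j * (2 * q + q_euler q (n + m - j)))"
  proof -
    have "(\<Sum>x<p ^ N. ?f (of_nat x) * (-1) ^ x) = ?c * (\<Sum>j\<le>2 * k. ?b j * ?T (n + m - j) N)" for N
      unfolding bernstein_poly_mult_eq[OF assms(4)] sum_distrib_left sum_distrib_right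
      by (subst sum.swap) (simp add: mult_ac)
    \<comment> \<open>Here \<open>j \<le> 2 * k < m + n\<close>, so the exponent is positive and the
      correction at index 0 does not occur.\<close>
    moreover have "?T (n + m - j) \<longlonglongrightarrow> 2 * q + q_euler q (n + m - j)" if "j \<le> 2 * k" for j
      using fermionic_limit[OF assms(2,3), of "n + m - j"] assms(4) that by simp
    ultimately show ?thesis
      by (simp only:) (intro tendsto_cmult_absv tendsto_sum_absv, simp)
  qed
  moreover have "?c * (\<Sum>j\<le>2 * k. ?b j * (2 * q + q_euler q (n + m - j))) =
      (if k = 0 then 2 * q + q_euler q (n + m)
       else ?c * (\<Sum>j=0..2 * k. ?b j * q_euler q (n + m - j)))"
  \<comment> \<open>For \<open>k = 0\<close> only \<open>j = 0\<close> remains and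
    \<open>2 * q\<close> survives; for \<open>k > 0\<close> it is multiplied by an alternating sum
    of binomial coefficients equal to 0.\<close>
  proof (cases "k = 0")
    case False
    then have "(\<Sum>j\<le>2 * k. ?b j) = 0"
      using choose_alternating_sum[of "2 * k", where ?'a = 'a] by (simp add: power_add mult.commute)
    then have "(\<Sum>j\<le>2 * k. ?b j * (2 * q)) = 0"
      by (simp only: sum_distrib_right[symmetric] mult_zero_left)
    then show ?thesis
      using False by (simp only: distrib_left sum.distrib atLeast0AtMost) simp
  qed simp
  ultimately show ?thesis
    unfolding has_fermionic_integral_def by simp
qed

end
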